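(* (Totally positive exchange lemma) Let $r,j,i_1,\dots,i_\ell\in\mathbb Z/n\mathbb Z$ be such that the words $r\,i_1\cdots i_\ell$ and $i_1\cdots i_\ell\,j$ are reduced. Suppose that $$e_r(a)e_{i_1}(a_1)\cdots e_{i_\ell}(a_\ell)=e_{i_1}(a'_1)\cdots e_{i_\ell}(a'_\ell)e_j(a')$$ with all of $a,a_1,\dots,a_\ell,a'_1,\dots,a'_\ell,a'$ positive reals. For each $m\le\ell$ and each $x\in\mathbb Z/n\mathbb Z$, let $S=\{s\le m: i_s=x\}$. Then $$\sum_{s\in S}a'_s\le\begin{cases}\sum_{s\in S}a_s & \text{if }x\ne r,\\ a+\sum_{s\in S}a_s & \text{if }x=r.\end{cases}$$
   Context: Elements of $GL_n(\mathbb R((t)))$ are identified with their unfoldings, the $\mathbb Z\times\mathbb Z$ matrices $(x_{i,j})$ with $x_{i+n,j+n}=x_{i,j}$ and $a_{ij}(t)=\sum_kx_{i,j+kn}t^k$. For $i\in\mathbb Z/n\mathbb Z$ and $a\in\mathbb R$, the Chevalley generator $e_i(a)$ is the identity except for entries $a$ at positions $(kn+i,kn+i+1)$, $k\in\mathbb Z$. A word $k_1\cdots k_p$ in $\mathbb Z/n\mathbb Z$ is reduced if $s_{k_1}\cdots s_{k_p}$ has length $p$ in the affine symmetric group $\tilde W$ with simple generators $s_i$, $i\in\mathbb Z/n\mathbb Z$. *)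

theory Defs
  imports Complex_Main "HOL-Number_Theory.Cong" "HOL-Library.Groups_Big_Fun"
begin

text \<open>
  Elements of \<open>\<int>/n\<int>\<close> are given by integer representatives; equality of residue classes is
  congruence modulo \<open>n\<close>. Elements of \<open>GL\<^sub>n(\<real>((t)))\<close> are given by their unfoldings, doubly infinite
  matrices indexed by \<open>\<int> \<times> \<int>\<close>. Throughout, \<open>n \<ge> 2\<close> is intended.
\<close>

type_synonym unfolded = "int \<Rightarrow> int \<Rightarrow> real"

text \<open>
  In an unfolding, every row vanishes far enough to the left and every column vanishes far enough
  down, so that the sum defining an entry of a product of unfoldings has only finitely many nonzero
  terms. \<^const>\<open>Sum_any\<close> is the sum over all integers of a function with finite support.
\<close>

definition unfolded_mult :: "unfolded \<Rightarrow> unfolded \<Rightarrow> unfolded"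
  where "unfolded_mult A B = (\<lambda>p q. Sum_any (\<lambda>k. A p k * B k q))"

definition unfolded_one :: unfolded
  where "unfolded_one = (\<lambda>p q. if p = q then 1 else 0)"

definition chevalley :: "nat \<Rightarrow> int \<Rightarrow> real \<Rightarrow> unfolded"
  where "chevalley n i a =
    (\<lambda>p q. if q = p then 1 else if q = p + 1 \<and> [p = i] (mod int n) then a else 0)"

text \<open>
  The product \<open>e\<^bsub>k\<^sub>1\<^esub>(a\<^sub>1) \<cdots> e\<^bsub>k\<^sub>p\<^esub>(a\<^sub>p)\<close>; both lists are meant to have the same length.
\<close>

definition chevalley_prod :: "nat \<Rightarrow> int list \<Rightarrow> real list \<Rightarrow> unfolded"
  where "chevalley_prod n ks as = foldr unfolded_mult (map2 (chevalley n) ks as) unfolded_one"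

text \<open>
  The affine symmetric group is realized as a group of permutations of \<open>\<int>\<close>: it is generated by
  the \<open>s\<^sub>i\<close> with \<open>i \<in> \<int>/n\<int>\<close>, where \<open>s\<^sub>i\<close> exchanges \<open>kn + i\<close> and \<open>kn + i + 1\<close> for all integers \<open>k\<close>.
\<close>

definition affine_gen :: "nat \<Rightarrow> int \<Rightarrow> int \<Rightarrow> int"
  where "affine_gen n i =
    (\<lambda>p. if [p = i] (mod int n) then p + 1
         else if [p = i + 1] (mod int n) then p - 1
         else p)"

definition affine_word :: "nat \<Rightarrow> int list \<Rightarrow> int \<Rightarrow> int"
  where "affine_word n ks = foldr (\<circ>) (map (affine_gen n) ks) id"

definition affine_length :: "nat \<Rightarrow> (int \<Rightarrow> int) \<Rightarrow> nat"
  where "affine_length n w = (LEAST p. \<exists>ks. length ks = p \<and> affine_word n ks = w)"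

definition reduced_word :: "nat \<Rightarrow> int list \<Rightarrow> bool"
  where "reduced_word n ks \<longleftrightarrow> affine_length n (affine_word n ks) = length ks"

end

theory Submission
  imports Defs
begin

text \<open>
  Both prefix products \<open>e\<^bsub>i\<^sub>1\<^esub>(a'\<^sub>1) \<cdots> e\<^bsub>i\<^sub>m\<^esub>(a'\<^sub>m)\<close> and
  \<open>e\<^sub>r(a) e\<^bsub>i\<^sub>1\<^esub>(a\<^sub>1) \<cdots> e\<^bsub>i\<^sub>m\<^esub>(a\<^sub>m)\<close> are left factors of the same matrix \<open>Z\<close>, one
  belonging to \<open>u = s\<^bsub>i\<^sub>1\<^esub> \<cdots> s\<^bsub>i\<^sub>m\<^esub>\<close> and the other to \<open>s\<^sub>r u\<close>, and the claim compares their
  entries at \<open>(x, x + 1)\<close>. As the cells of different group elements are disjoint, \<open>Z\<close> lies in the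
  cell of a single \<open>w = s\<^sub>r s\<^bsub>i\<^sub>1\<^esub> \<cdots> s\<^bsub>i\<^sub>\<ell>\<^esub> = s\<^bsub>i\<^sub>1\<^esub> \<cdots> s\<^bsub>i\<^sub>\<ell>\<^esub> s\<^sub>j\<close>, and a left factor
  of \<open>Z\<close> is determined by its group element. Think of \<open>u\<close> as an arrangement of wires labelled by
  integers, with wire \<open>r\<close> to the left of wire \<open>r + 1\<close>. These two wires are adjacent in \<open>w\<close>, so
  every other wire between them can be moved out by passing to a longer or shorter left factor of
  \<open>Z\<close>, and the same move applies to \<open>s\<^sub>r u\<close>. A move at a position other than \<open>x\<close> does not change
  the entry at \<open>(x, x + 1)\<close>, and the moves can avoid \<open>x\<close> because the two wires are less than \<open>n\<close>
  apart. Once the wires are adjacent, at the positions \<open>y\<close> and \<open>y + 1\<close>, we have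
  \<open>s\<^sub>r u = u s\<^sub>y\<close>, so the second left factor is the first one times some \<open>e\<^sub>y(c)\<close> with \<open>c > 0\<close>.
\<close>

subsection \<open>Reduced words\<close>

locale affine_rank =
  fixes n :: nat
  assumes n_ge_2: "n \<ge> 2"
begin

abbreviation cgr :: "int \<Rightarrow> int \<Rightarrow> bool" (infix "\<approx>" 50)
  where "p \<approx> q \<equiv> [p = q] (mod int n)"

abbreviation W :: "int list \<Rightarrow> int \<Rightarrow> int" where "W \<equiv> affine_word n"

abbreviation S :: "int \<Rightarrow> int \<Rightarrow> int" where "S \<equiv> affine_gen n"

text \<open>The inverse permutation: \<open>pos ks p\<close> is the position of wire \<open>p\<close>.\<close>

abbreviation pos :: "int list \<Rightarrow> int \<Rightarrow> int" where "pos ks \<equiv> affine_word n (rev ks)"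

section \<open>Residues modulo \<open>n\<close> and the generators as permutations of the
  integers\<close>

lemma cgr_add_right: "p + d \<approx> q + d \<longleftrightarrow> p \<approx> q"
  by (simp add: cong_iff_dvd_diff)

lemma cgr_close: "p \<approx> q \<Longrightarrow> \<bar>p - q\<bar> < int n \<Longrightarrow> p = q"
  by (metis cong_iff_dvd_diff dvd_imp_le_int linorder_not_le zero_less_abs_iff abs_of_nat abs_ge_self
      right_minus_eq)

lemma not_cgr_Suc: "\<not> p \<approx> p + 1" "\<not> p + 1 \<approx> p"
  using cgr_close[of p "p + 1"] cgr_close[of "p + 1" p] n_ge_2 by auto

lemma gen_at: "p \<approx> i \<Longrightarrow> S i p = p + 1"
  by (simp add: affine_gen_def)

lemma gen_at_Suc: "p \<approx> i + 1 \<Longrightarrow> S i p = p - 1"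
  using not_cgr_Suc by (metis affine_gen_def cong_sym cong_trans)

lemma gen_other: "\<not> p \<approx> i \<Longrightarrow> \<not> p \<approx> i + 1 \<Longrightarrow> S i p = p"
  by (simp add: affine_gen_def)

lemma gen_cases:
  obtains "p \<approx> i" "S i p = p + 1" | "p \<approx> i + 1" "S i p = p - 1"
    | "\<not> p \<approx> i" "\<not> p \<approx> i + 1" "S i p = p"
  using gen_at gen_at_Suc gen_other by metis

lemma gen_invol [simp]: "S i (S i p) = p"
proof (cases rule: gen_cases[of p i])
  case 1
  then show ?thesis using gen_at_Suc[of "p + 1" i] by (simp add: cgr_add_right)
next
  case 2
  then have "p - 1 \<approx> i" using cgr_add_right[of "p - 1" 1 i] by simp
  with 2 show ?thesis using gen_at[of "p - 1" i] by simp
qed simp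

lemma gen_comp_gen [simp]: "S i \<circ> S i = id" "S i \<circ> (S i \<circ> f) = f"
  by (auto simp: fun_eq_iff)

lemma gen_cong: "i \<approx> k \<Longrightarrow> S i = S k"
proof -
  assume ik: "i \<approx> k"
  then have "i + 1 \<approx> k + 1" by (simp add: cgr_add_right)
  with ik have "p \<approx> i \<longleftrightarrow> p \<approx> k" "p \<approx> i + 1 \<longleftrightarrow> p \<approx> k + 1" for p
    by (simp_all add: cong_def)
  then show "S i = S k" unfolding affine_gen_def by (simp only:)
qed

lemma gen_shift: "S i (p + int n * k) = S i p + int n * k"
proof -
  have "p + int n * k \<approx> q \<longleftrightarrow> p \<approx> q" for q
    by (simp add: cong_def)
  then show ?thesis by (simp add: affine_gen_def)
qed

lemma word_Nil [simp]: "W [] = id"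
  by (simp add: affine_word_def)

lemma word_Cons [simp]: "W (i # ks) = S i \<circ> W ks"
  by (simp add: affine_word_def)

lemma word_append [simp]: "W (ks @ ls) = W ks \<circ> W ls"
  by (induction ks) (simp_all add: comp_assoc)

lemma word_pos [simp]: "W ks (pos ks p) = p"
  by (induction ks arbitrary: p) simp_all

lemma pos_word [simp]: "pos ks (W ks p) = p"
  using word_pos[of "rev ks"] by simp

lemma word_shift: "W ks (p + int n * k) = W ks p + int n * k"
  by (induction ks) (simp_all add: gen_shift)

lemma word_inj [simp]: "W ks p = W ks q \<longleftrightarrow> p = q"
  by (metis pos_word)

lemma pos_eq_iff: "pos ks = pos ls \<longleftrightarrow> W ks = W ls"
  by (metis pos_word word_pos ext)

lemma word_cgr [simp]: "W ks p \<approx> W ks q \<longleftrightarrow> p \<approx> q"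
proof
  show "W ks p \<approx> W ks q" if "p \<approx> q" for p q and ks
  proof -
    from that obtain k where "p = q + int n * k" by (metis cong_iff_lin cong_sym)
    then show ?thesis by (simp add: word_shift cong_def)
  qed
  from this[of "W ks p" "W ks q" "rev ks"] show "W ks p \<approx> W ks q \<Longrightarrow> p \<approx> q" by simp
qed

text \<open>Conjugation of a simple reflection: periodicity carries the pair \<open>y\<close>,
  \<open>y + 1\<close> to all its translates, and elsewhere both sides act as
  \<open>W ks\<close>.\<close>

lemma word_gen_commute:
  assumes "W ks y = p" "W ks (y + 1) = p + 1"
  shows "S p \<circ> W ks = W ks \<circ> S y"
proof
  fix t
  show "(S p \<circ> W ks) t = (W ks \<circ> S y) t"
  proof (cases rule: gen_cases[of t y])
    case 1
    then obtain k where "t = y + int n * k" by (metis cong_iff_lin cong_sym)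
    then have "W ks t = p + int n * k" "W ks (t + 1) = p + 1 + int n * k"
      using assms word_shift[of ks y k] word_shift[of ks "y + 1" k] by (simp_all add: algebra_simps)
    moreover from this have "W ks t \<approx> p" by (simp add: cong_def)
    ultimately show ?thesis using 1 by (simp add: gen_at)
  next
    case 2
    then obtain k where "t = y + 1 + int n * k" by (metis cong_iff_lin cong_sym)
    then have "W ks t = p + 1 + int n * k" "W ks (t - 1) = p + int n * k"
      using assms word_shift[of ks y k] word_shift[of ks "y + 1" k] by (simp_all add: algebra_simps)
    moreover from this have "W ks t \<approx> p + 1" by (simp add: cong_def)
    ultimately show ?thesis using 2 by (simp add: gen_at_Suc)
  next
    case 3
    then show ?thesis using word_cgr[of ks t y] word_cgr[of ks t "y + 1"] assms by (simp add: gen_other)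
  qed
qed

text \<open>\<open>S k\<close> moves each integer by at most 1, so it can only reverse the order of
  neighbours that it exchanges.\<close>

lemma gen_less:
  assumes "p < q" "\<not> (q = p + 1 \<and> p \<approx> k)"
  shows "S k p < S k q"
proof (rule ccontr)
  assume neg: "\<not> S k p < S k q"
  have "S k p \<noteq> S k q" using assms(1) by (metis gen_invol less_irrefl)
  with neg have gt: "S k q < S k p" by simp
  have "S k p \<le> p + 1" "S k q \<ge> q - 1"
    by (cases rule: gen_cases[of p k]; simp) (cases rule: gen_cases[of q k]; simp)
  with gt assms(1) have *: "q = p + 1" by linarith
  then show False
    using assms(2) gt
    by (cases rule: gen_cases[of p k]; cases rule: gen_cases[of q k]) (auto simp: cgr_add_right)
qed

text \<open>The exchange condition. Follow the inversion of the wires \<open>i\<close> and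
  \<open>i + 1\<close> to the letter that creates it: there the wires are neighbours, so
  \<open>S i\<close> on the left acts as that letter on the right and cancels it.\<close>

lemma exchange:
  assumes "pos ks i > pos ks (i + 1)"
  shows "\<exists>ls. Suc (length ls) = length ks \<and> W ls = S i \<circ> W ks"
  using assms
proof (induction ks rule: rev_induct)
  case Nil
  then show ?case by simp
next
  case (snoc k ks)
  show ?case
  proof (cases "pos ks i > pos ks (i + 1)")
    case True
    with snoc.IH obtain ls where "Suc (length ls) = length ks" "W ls = S i \<circ> W ks" by blast
    then show ?thesis by (intro exI[of _ "ls @ [k]"]) (simp add: comp_assoc)
  next
    case False
    let ?y = "pos ks i"
    have "pos ks i < pos ks (i + 1)"
      using False by (metis add_cancel_left_right linorder_neqE word_inj zero_neq_one)
    with gen_less[of ?y "pos ks (i + 1)" k] snoc.prems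
    have y: "pos ks (i + 1) = ?y + 1" "?y \<approx> k" by auto
    have "S i \<circ> W ks = W ks \<circ> S ?y"
      by (rule word_gen_commute) (use word_pos[of ks "i + 1"] y in simp_all)
    also have "\<dots> = W ks \<circ> S k" using gen_cong[OF y(2)] by simp
    finally have comm: "S i \<circ> W ks = W ks \<circ> S k" .
    have "S i \<circ> W (ks @ [k]) = W ks"
      by (rule ext) (use fun_cong[OF comm, of "S k _"] in simp)
    then show ?thesis by (metis length_append_singleton)
  qed
qed

section \<open>Minimal length, descents and inversions\<close>

abbreviation red :: "int list \<Rightarrow> bool" where "red \<equiv> reduced_word n"

lemma reduced_iff: "red ks \<longleftrightarrow> (\<forall>ls. W ls = W ks \<longrightarrow> length ks \<le> length ls)"
proof -
  let ?P = "\<lambda>p. \<exists>ls. length ls = p \<and> W ls = W ks"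
  have "?P (length ks)" by blast
  then have "?P (Least ?P)" "Least ?P \<le> length ks"
    by (rule LeastI, rule Least_le)
  moreover have "Least ?P \<le> length ls" if "W ls = W ks" for ls
    using that by (intro Least_le) blast
  ultimately show ?thesis
    unfolding reduced_word_def affine_length_def by (metis le_antisym)
qed

lemma reduced_same_length:
  "red ks \<Longrightarrow> W ls = W ks \<Longrightarrow> length ls \<le> length ks \<Longrightarrow> red ls"
  unfolding reduced_iff by (metis le_trans)

lemma reduced_length_eq: "red ks \<Longrightarrow> red ls \<Longrightarrow> W ls = W ks \<Longrightarrow> length ls = length ks"
  unfolding reduced_iff by (metis le_antisym)

lemma reduced_exists: "\<exists>ls. red ls \<and> W ls = W ks"
proof -
  obtain ls where "W ls = W ks" "\<forall>ms. W ms = W ks \<longrightarrow> length ls \<le> length ms"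
    using ex_has_least_nat[of "\<lambda>ls. W ls = W ks" ks length] by auto
  then show ?thesis by (intro exI[of _ ls]) (simp add: reduced_iff)
qed

lemma reduced_tl: "red (i # ks) \<Longrightarrow> red ks"
  unfolding reduced_iff
proof (intro allI impI)
  fix ls assume *: "\<forall>ls. W ls = W (i # ks) \<longrightarrow> length (i # ks) \<le> length ls" and "W ls = W ks"
  then have "W (i # ls) = W (i # ks)" by simp
  with * have "length (i # ks) \<le> length (i # ls)" by blast
  then show "length ks \<le> length ls" by simp
qed

text \<open>By \<open>exchange\<close>, a word with a left descent at \<open>i\<close> is shortened
  by \<open>S i\<close>. For the converse, \<open>exchange\<close> is applied to a shortest word of
  \<open>W (i # ks)\<close>, which has that descent, and leads back to \<open>W ks\<close>.\<close>

lemma reduced_Cons: "red (i # ks) \<longleftrightarrow> red ks \<and> pos ks i < pos ks (i + 1)"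
proof (intro iffI conjI)
  assume r: "red (i # ks)"
  show "red ks" using r by (rule reduced_tl)
  show "pos ks i < pos ks (i + 1)"
  proof (rule ccontr)
    assume "\<not> ?thesis"
    then have "pos ks (i + 1) < pos ks i"
      by (metis add_cancel_left_right linorder_neqE word_inj zero_neq_one)
    from exchange[OF this] obtain ls where "Suc (length ls) = length ks" "W ls = W (i # ks)" by auto
    with r show False unfolding reduced_iff by (metis length_Cons Suc_n_not_le_n le_SucI)
  qed
next
  assume r: "red ks \<and> pos ks i < pos ks (i + 1)"
  obtain ls where ls: "red ls" "W ls = W (i # ks)" using reduced_exists by blast
  have "pos ls p = pos (i # ks) p" for p using ls(2) pos_eq_iff[of ls "i # ks"] by metis
  then have "pos ls (i + 1) < pos ls i" using r by (simp add: gen_at gen_at_Suc)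
  from exchange[OF this] obtain ms where "Suc (length ms) = length ls" "W ms = S i \<circ> W ls" by blast
  moreover from this ls(2) have "W ms = W ks" by simp
  ultimately have "length ks < length ls" using r unfolding reduced_iff
    by (metis Suc_le_eq less_eq_Suc_le le_imp_less_Suc)
  then show "red (i # ks)" using reduced_same_length[OF ls(1)] ls(2) by simp
qed

lemma reduced_rev: "red (rev ks) \<longleftrightarrow> red ks"
proof -
  have "red (rev ks)" if "red ks" for ks
    unfolding reduced_iff
  proof (intro allI impI)
    fix ls assume "W ls = W (rev ks)"
    then have "W (rev ls) = W ks" using pos_eq_iff[of ls "rev ks"] by simp
    with that have "length ks \<le> length (rev ls)" unfolding reduced_iff by blast
    then show "length (rev ks) \<le> length ls" by simp
  qed
  from this this[of "rev ks"] show ?thesis by auto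
qed

lemma reduced_snoc: "red (ks @ [k]) \<longleftrightarrow> red ks \<and> W ks k < W ks (k + 1)"
  using reduced_Cons[of k "rev ks"] reduced_rev[of ks] reduced_rev[of "ks @ [k]"] by simp

lemma reduced_appendD: "red (ks @ ls) \<Longrightarrow> red ks \<and> red ls"
proof
  assume "red (ks @ ls)"
  then show "red ls" by (induction ks) (auto simp: reduced_Cons)
  show "red ks" using \<open>red (ks @ ls)\<close>
    by (induction ls rule: rev_induct) (auto simp: reduced_snoc simp flip: append_assoc)
qed

text \<open>The exchange removes one letter, and \<open>i\<close> in front restores the length:
  every left descent is the first letter of some reduced word.\<close>

lemma left_descent_word:
  assumes "red ks" "pos ks i > pos ks (i + 1)"
  shows "\<exists>ls. red (i # ls) \<and> W (i # ls) = W ks"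
proof -
  from exchange[OF assms(2)] obtain ls where "Suc (length ls) = length ks" "W ls = S i \<circ> W ks" by blast
  moreover from this have "W (i # ls) = W ks" by simp
  ultimately have "red (i # ls)" using reduced_same_length[OF assms(1)] by simp
  with \<open>W (i # ls) = W ks\<close> show ?thesis by blast
qed

lemma right_descent_word:
  assumes "red ks" "W ks i > W ks (i + 1)"
  shows "\<exists>ls. red (ls @ [i]) \<and> W (ls @ [i]) = W ks"
proof -
  from left_descent_word[of "rev ks" i] assms obtain ls where
    "red (i # ls)" "W (i # ls) = W (rev ks)" by (auto simp: reduced_rev)
  then have "red (rev ls @ [i])" "W (rev ls @ [i]) = W ks"
    using reduced_rev[of "i # ls"] pos_eq_iff[of "i # ls" "rev ks"] by auto
  then show ?thesis by blast
qed

text \<open>To undo an inversion, a letter would have to exchange the two wires while they are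
  neighbours in inverted order. Up to a translation by a multiple of \<open>n\<close>, this
  contradicts the ascent condition of \<open>reduced_snoc\<close>.\<close>

lemma inversions_persist:
  assumes "red (ks @ ls)" "p < q" "pos ks q < pos ks p"
  shows "pos (ks @ ls) q < pos (ks @ ls) p"
  using assms(1)
proof (induction ls rule: rev_induct)
  case Nil
  then show ?case using assms(3) by simp
next
  case (snoc k ls)
  let ?w = "ks @ ls"
  have r: "red ?w" "W ?w k < W ?w (k + 1)"
    using snoc.prems reduced_snoc[of ?w k] by simp_all
  have IH: "pos ?w q < pos ?w p" using snoc.IH r(1) by blast
  have "S k (pos ?w q) < S k (pos ?w p)"
  proof (rule gen_less[OF IH], rule notI, elim conjE)
    assume a: "pos ?w p = pos ?w q + 1" "pos ?w q \<approx> k"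
    then obtain t where t: "pos ?w q = k + int n * t" by (metis cong_iff_lin cong_sym)
    have "q = W ?w k + int n * t" using t word_shift[of ?w k t] word_pos[of ?w q] by simp
    moreover have "p = W ?w (k + 1) + int n * t"
      using t a(1) word_shift[of ?w "k + 1" t] word_pos[of ?w p] by (simp add: algebra_simps)
    ultimately show False using r(2) assms(2) by simp
  qed
  then show ?case by simp
qed


subsection \<open>Cells\<close>

text \<open>Left multiplication by \<open>chevalley n i a\<close>. It makes sense for every doubly
  infinite matrix, so no finiteness condition has to be carried along.\<close>

definition row_add :: "int \<Rightarrow> real \<Rightarrow> unfolded \<Rightarrow> unfolded"
  where "row_add i a Y = (\<lambda>p q. if p \<approx> i then Y p q + a * Y (p + 1) q else Y p q)"

text \<open>
  Elements of a cell are represented by the operators of left multiplication, so that composition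
  replaces the product of unfoldings.
\<close>

fun cell :: "int list \<Rightarrow> (unfolded \<Rightarrow> unfolded) set"
  where "cell [] = {id}"
  | "cell (i # ks) = {row_add i a \<circ> T |a T. a > 0 \<and> T \<in> cell ks}"

lemma chevalley_mult: "unfolded_mult (chevalley n i a) Y = row_add i a Y"
proof (intro ext)
  fix p q
  have "Sum_any (\<lambda>k. chevalley n i a p k * Y k q) = (\<Sum>k\<in>{p, p + 1}. chevalley n i a p k * Y k q)"
    by (rule Sum_any.expand_superset) (auto simp: chevalley_def)
  also have "\<dots> = row_add i a Y p q"
    by (auto simp: chevalley_def row_add_def)
  finally show "unfolded_mult (chevalley n i a) Y p q = row_add i a Y p q"
    by (simp add: unfolded_mult_def)
qed

lemma chevalley_prod_Nil [simp]: "chevalley_prod n [] as = unfolded_one"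
  by (simp add: chevalley_prod_def)

lemma chevalley_prod_Cons [simp]:
  "chevalley_prod n (i # ks) (a # as) = row_add i a (chevalley_prod n ks as)"
  by (simp add: chevalley_prod_def chevalley_mult)

lemma row_add_row_add: "row_add i a (row_add i b Y) = row_add i (a + b) Y"
proof (intro ext)
  fix p q
  have "\<not> p + 1 \<approx> i" if "p \<approx> i"
    using that not_cgr_Suc(1)[of p] by (metis cong_sym cong_trans)
  then show "row_add i a (row_add i b Y) p q = row_add i (a + b) Y p q"
    by (auto simp: row_add_def algebra_simps)
qed

lemma row_add_zero [simp]: "row_add i 0 Y = Y"
  by (auto simp: row_add_def fun_eq_iff)

lemma row_add_cong: "i \<approx> k \<Longrightarrow> row_add i = row_add k"
  unfolding row_add_def fun_eq_iff by (simp add: cong_def)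

lemma row_add_commute:
  assumes "\<not> i \<approx> k" "\<not> i + 1 \<approx> k" "\<not> k + 1 \<approx> i"
  shows "row_add i a (row_add k b Y) = row_add k b (row_add i a Y)"
proof (intro ext)
  fix p q
  have "\<not> (p \<approx> i \<and> p + 1 \<approx> k)" "\<not> (p \<approx> k \<and> p + 1 \<approx> i)" "\<not> (p \<approx> i \<and> p \<approx> k)"
    using assms by (metis cgr_add_right cong_sym cong_trans)+
  then show "row_add i a (row_add k b Y) p q = row_add k b (row_add i a Y) p q"
    by (auto simp: row_add_def)
qed

text \<open>The braid relation with its usual change of parameters. The first hypothesis makes
  \<open>i\<close> and \<open>k\<close> neighbours on one side only, which excludes
  \<open>n = 2\<close>.\<close>

lemma row_add_braid:
  assumes k: "k \<approx> i + 1 \<and> \<not> k + 1 \<approx> i \<or> i \<approx> k + 1 \<and> \<not> i + 1 \<approx> k" and ac: "a + c \<noteq> 0"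
  shows "row_add i a (row_add k b (row_add i c Y)) =
    row_add k (b * c / (a + c)) (row_add i (a + c) (row_add k (a * b / (a + c)) Y))"
proof (intro ext)
  fix p q
  let ?L = "row_add i a (row_add k b (row_add i c Y)) p q"
  let ?R = "row_add k (b * c / (a + c)) (row_add i (a + c) (row_add k (a * b / (a + c)) Y)) p q"
  have split: "b * c / (a + c) + a * b / (a + c) = b"
    using ac by (simp add: divide_simps) (simp add: algebra_simps)
  have add2: "p + 1 + 1 = p + 2" by simp
  have suc: "p + 1 \<approx> u + 1 \<longleftrightarrow> p \<approx> u" "p + 2 \<approx> u + 1 \<longleftrightarrow> p + 1 \<approx> u" for u
    using cgr_add_right[of p 1 u] cgr_add_right[of "p + 1" 1 u] unfolding add2 .
  have ik: "\<not> i \<approx> k" using k not_cgr_Suc by (metis cong_sym cong_trans)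
  \<comment> \<open>Only rows in the classes of \<open>i\<close> and \<open>k\<close> change; those
    in the lower of the two neighbouring classes carry a quadratic term.\<close>
  consider "p \<approx> i" "k \<approx> i + 1" "\<not> k + 1 \<approx> i" | "p \<approx> k" "k \<approx> i + 1" "\<not> k + 1 \<approx> i"
    | "p \<approx> i" "i \<approx> k + 1" "\<not> i + 1 \<approx> k" | "p \<approx> k" "i \<approx> k + 1" "\<not> i + 1 \<approx> k"
    | "\<not> p \<approx> i" "\<not> p \<approx> k"
    using k by blast
  then show "?L = ?R"
  proof cases
    case 1
    then have "p + 1 \<approx> k" "\<not> p + 1 \<approx> i" "\<not> p + 2 \<approx> i" "\<not> p + 2 \<approx> k" "\<not> p \<approx> k"
      using suc ik not_cgr_Suc by (metis cong_sym cong_trans)+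
    then have "?L = Y p q + (a + c) * Y (p + 1) q + a * b * Y (p + 2) q"
      "?R = Y p q + (a + c) * Y (p + 1) q + (a + c) * (a * b / (a + c)) * Y (p + 2) q"
      using 1(1) by (simp_all add: row_add_def add2 algebra_simps)
    then show ?thesis using ac by simp
  next
    case 2
    then have "\<not> p + 1 \<approx> k" "\<not> p + 1 \<approx> i" "\<not> p \<approx> i"
      using suc ik not_cgr_Suc by (metis cong_sym cong_trans)+
    then have "?L = Y p q + b * Y (p + 1) q"
      "?R = Y p q + (b * c / (a + c) + a * b / (a + c)) * Y (p + 1) q"
      using 2(1) by (simp_all add: row_add_def algebra_simps)
    then show ?thesis using split by simp
  next
    case 3
    then have "\<not> p + 1 \<approx> k" "\<not> p + 1 \<approx> i" "\<not> p \<approx> k"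
      using suc ik not_cgr_Suc by (metis cong_sym cong_trans)+
    with 3(1) show ?thesis by (simp add: row_add_def algebra_simps)
  next
    case 4
    then have "p + 1 \<approx> i" "\<not> p + 1 \<approx> k" "\<not> p + 2 \<approx> i" "\<not> p + 2 \<approx> k" "\<not> p \<approx> i"
      using suc ik not_cgr_Suc by (metis cong_sym cong_trans)+
    then have "?L = Y p q + b * Y (p + 1) q + b * c * Y (p + 2) q"
      "?R = Y p q + (b * c / (a + c) + a * b / (a + c)) * Y (p + 1) q
        + (b * c / (a + c)) * (a + c) * Y (p + 2) q"
      using 4(1) by (simp_all add: row_add_def add2 algebra_simps add_divide_distrib)
    then show ?thesis using split ac by simp
  next
    case 5
    then show ?thesis by (simp add: row_add_def)
  qed
qed

section \<open>Cells under concatenation, commutations and braid moves\<close>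

lemma cell_cong_Cons: "i \<approx> k \<Longrightarrow> cell (i # ks) = cell (k # ks)"
  by (simp add: row_add_cong)

lemma cell_comp: "T \<in> cell ks \<Longrightarrow> U \<in> cell ls \<Longrightarrow> T \<circ> U \<in> cell (ks @ ls)"
proof (induction ks arbitrary: T)
  case (Cons i ks)
  then obtain a T' where T: "T = row_add i a \<circ> T'" "a > 0" "T' \<in> cell ks" by auto
  then have "T' \<circ> U \<in> cell (ks @ ls)" using Cons by blast
  moreover have "T \<circ> U = row_add i a \<circ> (T' \<circ> U)" unfolding T(1) by (rule comp_assoc)
  ultimately show ?case using T(2) unfolding append_Cons cell.simps by blast
qed simp

lemma cell_append_split: "V \<in> cell (ks @ ls) \<Longrightarrow> \<exists>T\<in>cell ks. \<exists>U\<in>cell ls. V = T \<circ> U"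
proof (induction ks arbitrary: V)
  case (Cons i ks)
  then obtain a V' where V: "V = row_add i a \<circ> V'" "a > 0" "V' \<in> cell (ks @ ls)" by auto
  then obtain T U where "T \<in> cell ks" "U \<in> cell ls" "V' = T \<circ> U" using Cons.IH by blast
  moreover from this V have "V = (row_add i a \<circ> T) \<circ> U" by (simp only: comp_assoc)
  moreover have "row_add i a \<circ> T \<in> cell (i # ks)" using V(2) \<open>T \<in> cell ks\<close> by auto
  ultimately show ?case by blast
qed simp

lemma cell_commute:
  assumes "\<not> i \<approx> k" "\<not> i + 1 \<approx> k" "\<not> k + 1 \<approx> i"
  shows "cell (i # k # ks) = cell (k # i # ks)"
proof -
  have "row_add i a \<circ> (row_add k b \<circ> T) = row_add k b \<circ> (row_add i a \<circ> T)"
    for a b and T :: "unfolded \<Rightarrow> unfolded"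
    by (rule ext) (simp add: row_add_commute[OF assms])
  then show ?thesis by (auto; metis)
qed

text \<open>The new parameters of the braid relation are formed by sums, products and quotients, so
  they stay positive.\<close>

lemma cell_braid_subset:
  assumes "k \<approx> i + 1 \<and> \<not> k + 1 \<approx> i \<or> i \<approx> k + 1 \<and> \<not> i + 1 \<approx> k"
  shows "cell (i # k # i # ks) \<subseteq> cell (k # i # k # ks)"
proof
  fix U assume "U \<in> cell (i # k # i # ks)"
  then obtain a b c T where U: "U = row_add i a \<circ> (row_add k b \<circ> (row_add i c \<circ> T))"
    and pos: "a > 0" "b > 0" "c > 0" "T \<in> cell ks" by auto
  have "U = row_add k (b * c / (a + c)) \<circ> (row_add i (a + c) \<circ> (row_add k (a * b / (a + c)) \<circ> T))"
    unfolding U by (rule ext) (use row_add_braid[OF assms, of a c b] pos in simp)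
  moreover have "b * c / (a + c) > 0" "a + c > 0" "a * b / (a + c) > 0" using pos by auto
  ultimately show "U \<in> cell (k # i # k # ks)" using pos(4) unfolding cell.simps by blast
qed

lemma cell_braid:
  assumes "k \<approx> i + 1 \<and> \<not> k + 1 \<approx> i \<or> i \<approx> k + 1 \<and> \<not> i + 1 \<approx> k"
  shows "cell (i # k # i # ks) = cell (k # i # k # ks)"
  using cell_braid_subset[OF assms] cell_braid_subset[of i k ks] assms by blast

lemma row_add_cell: "a > 0 \<Longrightarrow> T \<in> cell ks \<Longrightarrow> row_add i a \<circ> T \<in> cell (i # ks)"
  by auto

lemma chevalley_prod_cell:
  assumes "length as = length ks" "\<forall>a\<in>set as. a > 0"
  shows "\<exists>T\<in>cell ks. chevalley_prod n ks as = T unfolded_one"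
  using assms
proof (induction as ks rule: list_induct2)
  case Nil
  then show ?case by simp
next
  case (Cons a as i ks)
  then obtain T where "T \<in> cell ks" "chevalley_prod n ks as = T unfolded_one" by auto
  with Cons show ?case by (intro bexI[of _ "row_add i a \<circ> T"]) (simp_all del: cell.simps add: row_add_cell)
qed

text \<open>The same \<open>T\<close> serves the whole product and its prefix, so entries of the
  prefix can be read off from a left factor of the product.\<close>

lemma chevalley_prod_append_cell:
  assumes "length as = length ks" "\<forall>a\<in>set as. a > 0" "length bs = length ls" "\<forall>b\<in>set bs. b > 0"
  shows "\<exists>T U. T \<in> cell ks \<and> U \<in> cell ls \<and> chevalley_prod n (ks @ ls) (as @ bs) = T (U unfolded_one)
    \<and> chevalley_prod n ks as = T unfolded_one"
  using assms(1,2)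
proof (induction as ks rule: list_induct2)
  case Nil
  then show ?case using chevalley_prod_cell[OF assms(3,4)] by auto
next
  case (Cons a as i ks)
  then obtain T U where "T \<in> cell ks" "U \<in> cell ls"
    "chevalley_prod n (ks @ ls) (as @ bs) = T (U unfolded_one)"
    "chevalley_prod n ks as = T unfolded_one" by auto
  with Cons show ?case
    by - (rule exI[of _ "row_add i a \<circ> T"], rule exI[of _ U],
      simp del: cell.simps add: row_add_cell[unfolded comp_def] comp_def)
qed

lemma pos_Cons: "pos (i # ks) p = pos ks (S i p)"
  by simp

lemma reduced_descent: "red (i # ks) \<Longrightarrow> pos (i # ks) (i + 1) < pos (i # ks) i"
  unfolding reduced_Cons by (simp add: gen_at gen_at_Suc)

lemma gen_commute:
  assumes "\<not> i \<approx> k" "\<not> i + 1 \<approx> k" "\<not> k + 1 \<approx> i"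
  shows "S k \<circ> S i = S i \<circ> S k"
proof -
  have "\<not> k \<approx> i" "\<not> k \<approx> i + 1" "\<not> k + 1 \<approx> i + 1"
    using assms cgr_add_right cong_sym by blast+
  then show ?thesis
    using word_gen_commute[of "[i]" k k] assms(3) by (simp add: gen_other)
qed

text \<open>With descents at both \<open>i\<close> and \<open>i + 1\<close>, the element also has
  reduced words beginning with \<open>i, i + 1, i\<close> and with \<open>i + 1, i, i + 1\<close>.
  These differ by a braid move, and \<open>IH\<close> links each of them to one of the given
  words.\<close>

lemma cell_reduced_eq_adjacent:
  assumes r: "red (i # k1)" "red (k # k2)" and eq: "W (i # k1) = W (k # k2)" and ik: "k \<approx> i + 1"
    and IH: "\<And>us vs. length us < length (i # k1) \<Longrightarrow> red us \<Longrightarrow> red vs \<Longrightarrow> W us = W vs \<Longrightarrow> cell us = cell vs"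
  shows "cell (i # k1) = cell (k # k2)"
proof -
  have kS: "S k = S (i + 1)" using gen_cong[OF ik] .
  define f where "f = pos (i # k1)"
  have f_ls: "f = pos (k # k2)" unfolding f_def using eq pos_eq_iff by blast
  have f1: "f (i + 1) < f i" unfolding f_def using reduced_descent[OF r(1)] .
  \<comment> \<open>\<open>k\<close> is only a representative of the class of \<open>i + 1\<close>;
    translation by \<open>int n * t\<close> carries the descent at \<open>k\<close> to
    \<open>i + 1\<close>.\<close>
  obtain t where t: "i + 1 = k + int n * t" using ik by (metis cong_iff_lin)
  have "f (k + 1) < f k" unfolding f_ls using reduced_descent[OF r(2)] .
  moreover have "f (k + int n * t) = f k + int n * t" "f (k + 1 + int n * t) = f (k + 1) + int n * t"
    unfolding f_def by (simp_all only: word_shift)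
  moreover have "i + 2 = k + 1 + int n * t" using t by simp
  ultimately have f2: "f (i + 2) < f (i + 1)" by (simp only: t)
  \<comment> \<open>For \<open>n = 2\<close> periodicity gives \<open>f (i + 2) = f i + 2\<close>,
    against the two descents.\<close>
  have "int n \<noteq> 2"
  proof
    assume "int n = 2"
    then have "f (i + 2) = f i + 2" unfolding f_def using word_shift[of "rev (i # k1)" i 1] by simp
    with f1 f2 show False by simp
  qed
  then have i2: "\<not> i + 2 \<approx> i" "\<not> i + 2 \<approx> i + 1" "\<not> i \<approx> i + 2"
    using n_ge_2 cgr_close[of "i + 2" i] cgr_close[of "i + 2" "i + 1"] cgr_close[of i "i + 2"] by auto
  have r1: "red k1" and r2: "red k2" using r reduced_tl by blast+
  have k1: "pos k1 p = f (S i p)" for p unfolding f_def pos_Cons by simp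
  then have k1_vals: "pos k1 i = f (i + 1)" "pos k1 (i + 1) = f i" "pos k1 (i + 2) = f (i + 2)"
    using i2 by (simp_all add: gen_at gen_at_Suc gen_other)
  then obtain us where us: "red ((i + 1) # us)" "W ((i + 1) # us) = W k1"
    using left_descent_word[OF r1, of "i + 1"] f1 f2 by (auto simp: add.commute)
  have "pos us p = pos k1 (S (i + 1) p)" for p
    using us(2) pos_eq_iff[of "(i + 1) # us" k1] by (metis gen_invol pos_Cons)
  then have "pos us i = f (i + 1)" "pos us (i + 1) = f (i + 2)"
    using k1_vals gen_at[of "i + 1" "i + 1"] gen_other[of i "i + 1"] i2 not_cgr_Suc(1)[of i]
    by (simp_all add: add.assoc)
  then obtain vs where vs: "red (i # vs)" "W (i # vs) = W us"
    using left_descent_word[OF reduced_tl[OF us(1)], of i] f2 by auto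
  have len: "length ((i + 1) # us) = length k1" "length (i # vs) = length us"
    using reduced_length_eq[OF r1 us(1,2)] reduced_length_eq[OF reduced_tl[OF us(1)] vs] by auto
  have w3: "W ((i + 1) # i # vs) = W k1" using us(2) vs(2) by (metis word_Cons)
  have r3: "red ((i + 1) # i # vs)" by (rule reduced_same_length[OF r1 w3]) (use len in simp)
  have "cell ((i + 1) # i # vs) = cell k1" by (rule IH[OF _ r3 r1 w3]) (use len in simp)
  then have "cell (i # k1) = cell (i # (i + 1) # i # vs)" by (simp only: cell.simps)
  also have "\<dots> = cell ((i + 1) # i # (i + 1) # vs)"
    using i2(1) by (intro cell_braid) (simp add: add.commute)
  also have "\<dots> = cell (k # i # (i + 1) # vs)"
    using ik by (intro cell_cong_Cons) (rule cong_sym)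
  also have "cell (i # (i + 1) # vs) = cell k2"
  proof -
    \<comment> \<open>\<open>S i \<circ> S (i + 1)\<close> takes \<open>i\<close>,
      \<open>i + 1\<close> to \<open>i + 1\<close>, \<open>i + 2\<close>, so the braid relation is
      an instance of conjugation.\<close>
    have braid: "S (i + 1) \<circ> (S i \<circ> S (i + 1)) = (S i \<circ> S (i + 1)) \<circ> S i"
    proof -
      have "S (i + 1) i = i" "S i (2 + i) = 2 + i"
        using i2 not_cgr_Suc(1)[of i] by (simp_all add: gen_other add.assoc add.commute[of 2])
      then show ?thesis using word_gen_commute[of "[i, i + 1]" i "i + 1"] by (simp add: gen_at)
    qed
    have "W (k # i # (i + 1) # vs) = W (i # k1)"
      using braid unfolding word_Cons kS us(2)[symmetric] vs(2)[symmetric] by (metis comp_assoc)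
    then have "W (k # i # (i + 1) # vs) = W (k # k2)" using eq by simp
    moreover have "length (k # i # (i + 1) # vs) = length (k # k2)"
      using len reduced_length_eq[OF r eq[symmetric]] by simp
    ultimately have "red (k # i # (i + 1) # vs)" and w2: "W (i # (i + 1) # vs) = W k2"
      using reduced_same_length[OF r(2)] gen_comp_gen(2) by (metis le_refl, metis word_Cons)
    then have r4: "red (i # (i + 1) # vs)" using reduced_tl by blast
    show ?thesis by (rule IH[OF _ r4 r2 w2]) (use len in simp)
  qed
  then have "cell (k # i # (i + 1) # vs) = cell (k # k2)" by (simp only: cell.simps)
  finally show ?thesis .
qed

text \<open>The argument of Matsumoto's theorem: by induction on the length, compare the first
  letters, which are equal, commuting or neighbouring. Hence a cell depends only on the group
  element.\<close>

lemma cell_reduced_eq: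
  assumes "red ks" "red ls" "W ks = W ls"
  shows "cell ks = cell ls"
  using assms
proof (induction "length ks" arbitrary: ks ls rule: less_induct)
  case less
  note IH = less.hyps
  have len: "length ks = length ls" using reduced_length_eq less.prems by metis
  show ?case
  proof (cases ks)
    case Nil
    then show ?thesis using len by simp
  next
    case (Cons i k1)
    with len obtain k k2 where ls: "ls = k # k2" by (cases ls) auto
    have r1: "red k1" and r2: "red k2" using less.prems reduced_tl Cons ls by blast+
    have W12: "S i \<circ> W k1 = S k \<circ> W k2" using less.prems(3) Cons ls by simp
    have short: "length k1 < length ks" "length k2 < length ks" using Cons ls len by auto
    consider "i \<approx> k" | "\<not> i \<approx> k" "\<not> i + 1 \<approx> k" "\<not> k + 1 \<approx> i" | "k \<approx> i + 1" | "i \<approx> k + 1"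
      using cong_sym by blast
    then show ?thesis
    proof cases
      case 1
      then have "W k1 = W k2" using W12 gen_cong gen_comp_gen(2) by metis
      then have "cell k1 = cell k2" using IH[OF short(1) r1 r2] by simp
      with 1 show ?thesis using Cons ls row_add_cong[OF 1] by simp
    next
      case 2
      \<comment> \<open>The descent at \<open>k\<close> survives the removal of \<open>i\<close>, so
        there are reduced words beginning with \<open>i, k\<close> and with \<open>k, i\<close>;
        they tie \<open>ks\<close> to \<open>ls\<close>.\<close>
      have "\<not> k \<approx> i" "\<not> k \<approx> i + 1" "\<not> k + 1 \<approx> i + 1"
        using 2 cgr_add_right cong_sym by blast+
      then have "pos k1 k = pos ks k" "pos k1 (k + 1) = pos ks (k + 1)"
        using 2(3) unfolding Cons pos_Cons by (simp_all add: gen_other)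
      moreover have "pos ks (k + 1) < pos ks k"
        using reduced_descent[of k k2] less.prems ls pos_eq_iff by metis
      ultimately obtain us where us: "red (k # us)" "W (k # us) = W k1"
        using left_descent_word[OF r1, of k] by auto
      have "length (k # us) = length k1" using reduced_length_eq[OF r1 us] .
      then have l: "length (k # i # us) = length (k # k2)" using Cons ls len by simp
      have "W (k # i # us) = W ks"
        using us(2) gen_commute[OF 2] Cons by (metis word_Cons comp_assoc)
      then have w: "W (k # i # us) = W (k # k2)" using less.prems(3) ls by simp
      have "red (k # i # us)" using reduced_same_length[OF _ w] less.prems(2) ls l by simp
      moreover have "W (i # us) = W k2" using w gen_comp_gen(2) by (metis word_Cons)
      ultimately have "cell k2 = cell (i # us)" using IH[OF short(2) r2] reduced_tl by metis
      moreover have "cell k1 = cell (k # us)" using IH[OF short(1) r1 us(1)] us(2) by simp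
      ultimately have "cell ks = cell (i # k # us)" "cell ls = cell (k # i # us)"
        unfolding Cons ls by (simp_all only: cell.simps)
      then show ?thesis using cell_commute[OF 2] by metis
    next
      case 3
      then show ?thesis using cell_reduced_eq_adjacent[of i k1 k k2] IH less.prems Cons ls by metis
    next
      case 4
      then show ?thesis using cell_reduced_eq_adjacent[of k k2 i k1] IH less.prems Cons ls len by metis
    qed
  qed
qed

subsection \<open>Disjointness of cells\<close>

text \<open>The linear span of the rows up to \<open>p\<close>, built by adding one multiple of a
  row at a time so that finite combinations need no index sets.\<close>

inductive_set row_span :: "unfolded \<Rightarrow> int \<Rightarrow> (int \<Rightarrow> real) set" for X :: unfolded and p :: int
  where row_span_zero: "(\<lambda>q. 0) \<in> row_span X p"
  | row_span_step: "f \<in> row_span X p \<Longrightarrow> s \<le> p \<Longrightarrow> (\<lambda>q. f q + c * X s q) \<in> row_span X p"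

lemma row_span_add: "g \<in> row_span X p \<Longrightarrow> f \<in> row_span X p \<Longrightarrow> (\<lambda>q. f q + g q) \<in> row_span X p"
proof (induction rule: row_span.induct)
  case (row_span_step g s c)
  then show ?case using row_span.row_span_step[of "\<lambda>q. f q + g q" X p s c] by (simp add: add.assoc)
qed simp

lemma row_span_scale: "f \<in> row_span X p \<Longrightarrow> (\<lambda>q. d * f q) \<in> row_span X p"
proof (induction rule: row_span.induct)
  case row_span_zero
  then show ?case by (simp add: row_span.row_span_zero)
next
  case (row_span_step g s c)
  then show ?case using row_span.row_span_step[of "\<lambda>q. d * g q" X p s "d * c"]
    by (simp add: algebra_simps)
qed

lemma row_span_row: "s \<le> p \<Longrightarrow> X s \<in> row_span X p"
  using row_span_step[OF row_span_zero, where s = s and c = 1] by simp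

lemma row_span_subset: "(\<And>s. s \<le> p \<Longrightarrow> X s \<in> row_span Y p') \<Longrightarrow> row_span X p \<subseteq> row_span Y p'"
proof
  fix f assume rows: "\<And>s. s \<le> p \<Longrightarrow> X s \<in> row_span Y p'" and "f \<in> row_span X p"
  from this(2) show "f \<in> row_span Y p'"
  proof (induction rule: row_span.induct)
    case (row_span_step f s c)
    then show ?case using row_span_add row_span_scale rows by blast
  qed (rule row_span_zero)
qed

lemma row_span_mono: "p \<le> p' \<Longrightarrow> row_span X p \<subseteq> row_span X p'"
  by (intro row_span_subset row_span_row) simp

lemma row_span_split:
  "f \<in> row_span X p \<Longrightarrow> \<exists>g c. g \<in> row_span X (p - 1) \<and> f = (\<lambda>q. g q + c * X p q)"
proof (induction rule: row_span.induct)
  case row_span_zero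
  show ?case by (intro exI[of _ "\<lambda>q. 0"] exI[of _ 0]) (simp add: row_span.row_span_zero)
next
  case (row_span_step f s d)
  then obtain g c where g: "g \<in> row_span X (p - 1)" "f = (\<lambda>q. g q + c * X p q)" by blast
  show ?case
  proof (cases "s = p")
    case True
    then show ?thesis using g by (intro exI[of _ g] exI[of _ "c + d"]) (auto simp: algebra_simps)
  next
    case False
    then have "(\<lambda>q. g q + d * X s q) \<in> row_span X (p - 1)"
      using g(1) row_span_step(2) by (intro row_span.row_span_step) auto
    then show ?thesis using g(2) by (intro exI[of _ "\<lambda>q. g q + d * X s q"] exI[of _ c]) (auto simp: algebra_simps)
  qed
qed

lemma row_span_lin:
  "f \<in> row_span X p \<Longrightarrow> g \<in> row_span X p \<Longrightarrow> (\<lambda>q. d * f q + e * g q) \<in> row_span X p"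
  by (intro row_span_add row_span_scale)

text \<open>
  The pivots of an element of the cell of \<open>w\<close> are \<open>w\<^sup>-\<^sup>1(q)\<close> for \<open>q \<le> p\<close>;
  this is what separates the cells.
\<close>

definition pivots :: "unfolded \<Rightarrow> int \<Rightarrow> int set"
  where "pivots X p = {t. \<exists>f\<in>row_span X p. f t \<noteq> 0 \<and> (\<forall>q>t. f q = 0)}"

lemma pivots_subset: "row_span X p \<subseteq> row_span Y p' \<Longrightarrow> pivots X p \<subseteq> pivots Y p'"
  unfolding pivots_def by blast

lemma pivots_one: "pivots unfolded_one p = {..p}"
proof -
  have "f q = 0" if "f \<in> row_span unfolded_one p" "q > p" for f q
    using that by (induction rule: row_span.induct) (auto simp: unfolded_one_def)
  moreover have "t \<in> pivots unfolded_one p" if "t \<le> p" for t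
    unfolding pivots_def mem_Collect_eq
    by (rule bexI[OF _ row_span_row[OF that]]) (simp add: unfolded_one_def)
  ultimately show ?thesis unfolding pivots_def by (auto simp flip: not_less)
qed

text \<open>A row \<open>s\<close> borrows only from row \<open>s + 1\<close>, which lies beyond
  \<open>p\<close> only for \<open>s = p\<close>, and row \<open>p\<close> is not altered.\<close>

lemma row_span_row_add_subset:
  assumes "\<not> p \<approx> i"
  shows "row_span (row_add i a Y) p \<subseteq> row_span Y p"
proof (rule row_span_subset)
  fix s assume s: "s \<le> p"
  show "row_add i a Y s \<in> row_span Y p"
  proof (cases "s \<approx> i")
    case True
    then have "s + 1 \<le> p" using s assms by (cases "s = p") auto
    with True show ?thesis
      using row_span_step[OF row_span_row[OF s], of "s + 1" Y a] by (simp add: row_add_def)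
  next
    case False
    then show ?thesis using row_span_row[OF s] by (simp add: row_add_def)
  qed
qed

lemma row_span_row_add:
  assumes "\<not> p \<approx> i"
  shows "row_span (row_add i a Y) p = row_span Y p"
  using row_span_row_add_subset[OF assms, of a Y] row_span_row_add_subset[OF assms, of "- a" "row_add i a Y"]
  by (auto simp: row_add_row_add)

text \<open>Row \<open>p\<close> brings the pivot \<open>s\<close>, row \<open>p + 1\<close> the
  larger pivot \<open>t\<close>. A nonzero multiple of row \<open>p + 1\<close> added to row
  \<open>p\<close> lets the larger pivot win, so \<open>t\<close> replaces \<open>s\<close>.\<close>

lemma pivots_row_add_at:
  assumes "p \<approx> i" "a \<noteq> 0" "s < t" "s \<notin> pivots Y (p - 1)" "t \<notin> pivots Y p"
    and ps: "pivots Y p = insert s (pivots Y (p - 1))"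
    and pt: "pivots Y (p + 1) = insert t (pivots Y p)"
  shows "pivots (row_add i a Y) p = insert t (pivots Y (p - 1))"
proof -
  let ?X = "row_add i a Y"
  let ?V = "row_span Y (p - 1)"
  let ?U = "row_span ?X p"
  have V: "row_span ?X (p - 1) = ?V" and V2: "row_span ?X (p + 1) = row_span Y (p + 1)"
    using assms(1) not_cgr_Suc by (intro row_span_row_add; metis cgr_add_right cong_sym cong_trans diff_add_cancel)+
  have VU: "?V \<subseteq> ?U" using row_span_mono[of "p - 1" p ?X] V by simp
  have U2: "?U \<subseteq> row_span Y (p + 1)" using row_span_mono[of p "p + 1" ?X] V2 by simp
  have Xp: "?X p = (\<lambda>q. Y p q + a * Y (p + 1) q)" using assms(1) by (simp add: row_add_def)
  obtain g where g: "g \<in> row_span Y (p + 1)" "g t \<noteq> 0" "\<forall>q>t. g q = 0"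
    using pt unfolding pivots_def by blast
  obtain h where h: "h \<in> row_span Y p" "h s \<noteq> 0" "\<forall>q>s. h q = 0"
    using ps unfolding pivots_def by blast
  from row_span_split[OF g(1)] obtain g1 c1 where g1: "g1 \<in> row_span Y p" "g = (\<lambda>q. g1 q + c1 * Y (p + 1) q)"
    by auto
  from row_span_split[OF g1(1)] obtain g2 c2 where g2: "g2 \<in> ?V" "g1 = (\<lambda>q. g2 q + c2 * Y p q)"
    by auto
  from row_span_split[OF h(1)] obtain h1 d1 where h1: "h1 \<in> ?V" "h = (\<lambda>q. h1 q + d1 * Y p q)"
    by auto
  have c1: "c1 \<noteq> 0" using g g1 assms(5) unfolding pivots_def by auto
  have d1: "d1 \<noteq> 0" using h h1 assms(4) unfolding pivots_def by auto
  \<comment> \<open>Modulo the rows above \<open>p\<close>, the new row \<open>p\<close> is \<open>e\<close>, a combination of \<open>g\<close> and \<open>h\<close> with pivot \<open>t\<close>.\<close>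
  define b where "b = a / c1"
  define d where "d = (1 - b * c2) / d1"
  have bd: "b * c1 = a" "b * c2 + d * d1 = 1" unfolding b_def d_def using c1 d1 by simp_all
  define e where "e = (\<lambda>q. b * g q + d * h q)"
  define v where "v = (\<lambda>q. b * g2 q + d * h1 q)"
  have v: "v \<in> ?V" unfolding v_def by (intro row_span_lin g2 h1)
  have eX: "e = (\<lambda>q. v q + 1 * ?X p q)"
  proof
    fix q
    have "e q = v q + ((b * c2 + d * d1) * Y p q + b * c1 * Y (p + 1) q)"
      unfolding e_def v_def g1(2) g2(2) h1(2) by (simp add: algebra_simps)
    then show "e q = v q + 1 * ?X p q" unfolding bd Xp by simp
  qed
  have eU: "e \<in> ?U" unfolding eX using row_span_step[OF subsetD[OF VU v] order_refl] .
  have et: "e t \<noteq> 0" "\<forall>q>t. e q = 0" using g(2,3) h(3) assms(2,3) c1 by (simp_all add: e_def b_def)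
  have "pivots Y (p - 1) \<subseteq> pivots ?X p" using VU by (rule pivots_subset)
  moreover have "t \<in> pivots ?X p" using eU et unfolding pivots_def by blast
  \<comment> \<open>The span of the rows up to \<open>p + 1\<close> is unchanged, so at most
    \<open>s\<close> and \<open>t\<close> can be added.\<close>
  moreover have "pivots ?X p \<subseteq> insert s (insert t (pivots Y (p - 1)))"
    using pivots_subset[OF U2] by (simp only: ps pt insert_commute)
  moreover have "s \<notin> pivots ?X p"
  proof
    assume "s \<in> pivots ?X p"
    then obtain k where k: "k \<in> ?U" "k s \<noteq> 0" "\<forall>q>s. k q = 0" unfolding pivots_def by blast
    from row_span_split[OF k(1)] V obtain k1 l where k1: "k1 \<in> ?V" "k = (\<lambda>q. k1 q + l * ?X p q)" by auto
    have "l \<noteq> 0" using k k1 assms(4) unfolding pivots_def by auto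
    \<comment> \<open>\<open>z\<close> equals \<open>k - l * e\<close>: row \<open>p\<close>
      cancels, and the pivot \<open>t\<close> of \<open>e\<close> remains in a span that does not
      have it.\<close>
    define z where "z = (\<lambda>q. 1 * k1 q + (- l) * v q)"
    have z: "z \<in> ?V" unfolding z_def by (intro row_span_lin k1 v)
    have "z q = k q - l * e q" for q unfolding z_def eX k1(2) by (simp add: algebra_simps)
    then have "z t \<noteq> 0" "\<forall>q>t. z q = 0" using k(3) assms(3) et \<open>l \<noteq> 0\<close> by auto
    with z have "t \<in> pivots Y (p - 1)" unfolding pivots_def by blast
    with assms(5) show False using ps by blast
  qed
  ultimately show ?thesis by blast
qed

lemma gen_image_atMost:
  assumes "\<not> p \<approx> i"
  shows "S i ` {..p} = {..p}"
proof
  show sub: "S i ` {..p} \<subseteq> {..p}"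
  proof
    fix q assume "q \<in> S i ` {..p}"
    then obtain r where r: "r \<le> p" "q = S i r" by auto
    then show "q \<in> {..p}" using assms by (cases rule: gen_cases[of r i]) (auto simp: order_le_less)
  qed
  show "{..p} \<subseteq> S i ` {..p}"
  proof
    fix q assume "q \<in> {..p}"
    then have "S i q \<in> {..p}" using sub by blast
    then show "q \<in> S i ` {..p}" by (intro image_eqI[of _ _ "S i q"]) simp_all
  qed
qed

text \<open>For \<open>p\<close> congruent to \<open>i\<close>, \<open>S i\<close> turns
  \<open>{..p}\<close> into \<open>{..p}\<close> with \<open>p\<close> replaced by
  \<open>p + 1\<close>, as the pivots do. The parameter is merely nonzero because
  \<open>cell_prefix_unique\<close> uses a difference of either sign.\<close>

lemma pivots_row_add:
  assumes Y: "\<And>p. pivots Y p = pos ks ` {..p}" and "a \<noteq> 0" "pos ks i < pos ks (i + 1)"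
  shows "pivots (row_add i a Y) p = pos (i # ks) ` {..p}"
proof (cases "p \<approx> i")
  case False
  have "S i ` {..p} = {..p}" using False by (rule gen_image_atMost)
  moreover have "pos (i # ks) ` {..p} = pos ks ` S i ` {..p}" by (simp add: image_image)
  ultimately have "pos (i # ks) ` {..p} = pos ks ` {..p}" by simp
  with False Y show ?thesis by (simp add: pivots_def row_span_row_add)
next
  case True
  then obtain t where t: "p = i + int n * t" by (metis cong_iff_lin cong_sym)
  then have "p + 1 = (i + 1) + int n * t" by simp
  with t assms(3) have lt: "pos ks p < pos ks (p + 1)" by (simp only: word_shift)
  have atMost: "{..p} = insert p {..p - 1}" "{..p + 1} = insert (p + 1) {..p}" by auto
  have "pivots (row_add i a Y) p = insert (pos ks (p + 1)) (pivots Y (p - 1))"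
    by (rule pivots_row_add_at[OF True assms(2) lt]) (use atMost in \<open>auto simp: Y\<close>)
  moreover have "S i ` {..p} = insert (p + 1) {..p - 1}"
  proof -
    have "S i ` {..p - 1} = {..p - 1}"
      using gen_image_atMost[of "p - 1" i] True not_cgr_Suc(1)[of "p - 1"]
      by (metis cong_sym cong_trans diff_add_cancel)
    then show ?thesis using atMost(1) True by (simp add: gen_at)
  qed
  moreover have "pos (i # ks) ` {..p} = pos ks ` S i ` {..p}" by (simp add: image_image)
  ultimately show ?thesis using Y by simp
qed


section \<open>Separation of cells and uniqueness of factorizations\<close>

lemma pivots_cell:
  "red ks \<Longrightarrow> T \<in> cell ks \<Longrightarrow> pivots (T unfolded_one) p = pos ks ` {..p}"
proof (induction ks arbitrary: T p)
  case Nil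
  then show ?case by (simp add: pivots_one)
next
  case (Cons i ks)
  then obtain a U where T: "T = row_add i a \<circ> U" "a > 0" "U \<in> cell ks" by auto
  have "pivots (U unfolded_one) p = pos ks ` {..p}" for p
    using Cons.IH Cons.prems(1) T(3) reduced_tl by blast
  from pivots_row_add[OF this, of a i p] Cons.prems(1) T(1,2) show ?case
    by (simp only: reduced_Cons comp_apply)
qed

lemma word_eq_if_images_eq:
  assumes "\<And>p. pos ks ` {..p} = pos ls ` {..p}"
  shows "W ks = W ls"
proof -
  have "pos ks p = pos ls p" for p
  proof -
    have "pos us ` {..p} - pos us ` {..p - 1} = {pos us p}" for us
    proof -
      have "{..p} = insert p {..p - 1}" by auto
      then show ?thesis by auto
    qed
    from this[of ks] this[of ls] assms show ?thesis by simp
  qed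
  then show ?thesis using pos_eq_iff by blast
qed

lemma cell_disjoint:
  assumes "red ks" "red ls" "T \<in> cell ks" "U \<in> cell ls" "T unfolded_one = U unfolded_one"
  shows "W ks = W ls"
  by (rule word_eq_if_images_eq) (use pivots_cell assms in metis)

text \<open>Compare the first parameters \<open>a\<close> and \<open>b\<close>. If they differed, a
  factor \<open>row_add i (a - b)\<close> would change the pivots from those of
  \<open>ks @ ls\<close> to those of \<open>i # ks @ ls\<close>, yet both remainders have the
  former.\<close>

lemma cell_prefix_unique:
  assumes "red (ks @ ls)" "T \<in> cell ks" "T' \<in> cell ks" "U \<in> cell ls" "U' \<in> cell ls"
    "T (U unfolded_one) = T' (U' unfolded_one)"
  shows "T = T'"
  using assms
proof (induction ks arbitrary: T T')
  case (Cons i ks)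
  obtain a V where T: "T = row_add i a \<circ> V" "a > 0" "V \<in> cell ks" using Cons.prems(2) by auto
  obtain b V' where T': "T' = row_add i b \<circ> V'" "b > 0" "V' \<in> cell ks" using Cons.prems(3) by auto
  let ?Y = "V (U unfolded_one)" and ?Y' = "V' (U' unfolded_one)"
  have r: "red (i # (ks @ ls))" using Cons.prems(1) by simp
  have "row_add i (- b) (row_add i a ?Y) = row_add i (- b) (row_add i b ?Y')"
    using Cons.prems(6) T(1) T'(1) by simp
  then have eq: "row_add i (a - b) ?Y = ?Y'" by (simp add: row_add_row_add)
  have Y: "pivots ?Y p = pos (ks @ ls) ` {..p}" and Y': "pivots ?Y' p = pos (ks @ ls) ` {..p}" for p
    using pivots_cell[OF reduced_tl[OF r] cell_comp[OF T(3) Cons.prems(4)], of p]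
      pivots_cell[OF reduced_tl[OF r] cell_comp[OF T'(3) Cons.prems(5)], of p] by (simp_all only: comp_apply)
  have "a = b"
  proof (rule ccontr)
    assume "a \<noteq> b"
    have "pos (i # (ks @ ls)) ` {..p} = pos (ks @ ls) ` {..p}" for p
      using pivots_row_add[OF Y, of "a - b" i p] \<open>a \<noteq> b\<close> r eq Y'[of p] by (simp only: reduced_Cons)
    then have "W (i # (ks @ ls)) = W (ks @ ls)" by (rule word_eq_if_images_eq)
    then have "S i (W (ks @ ls) q) = W (ks @ ls) q" for q by (metis comp_apply word_Cons)
    from this[of "pos (ks @ ls) i"] have "S i i = i" by (simp only: word_pos)
    then show False by (simp add: gen_at)
  qed
  then have "?Y = ?Y'" using eq by simp
  then have "V = V'" using Cons.IH[OF reduced_tl[OF r] T(3) T'(3) Cons.prems(4,5)] by simp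
  with \<open>a = b\<close> T(1) T'(1) show ?case by simp
qed simp

section \<open>The entry at \<open>(x, x + 1)\<close> is additive on products\<close>

definition superdiag :: "int \<Rightarrow> (unfolded \<Rightarrow> unfolded) \<Rightarrow> real"
  where "superdiag x T = T unfolded_one x (x + 1)"

lemma cell_diag: "T \<in> cell ks \<Longrightarrow> q < p \<Longrightarrow> T unfolded_one p q = 0"
  and cell_diag_one: "T \<in> cell ks \<Longrightarrow> T unfolded_one p p = 1"
proof (induction ks arbitrary: T p q)
  case Nil
  { case 1 then show ?case by (simp add: unfolded_one_def) }
  { case 2 then show ?case by (simp add: unfolded_one_def) }
next
  case (Cons i ks)
  { case 1
    then obtain a V where "T = row_add i a \<circ> V" "V \<in> cell ks" by auto
    then show ?case using Cons.IH(1)[of V q p] Cons.IH(1)[of V q "p + 1"] 1(2)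
      by (simp add: row_add_def) }
  { case 2
    then obtain a V where "T = row_add i a \<circ> V" "V \<in> cell ks" by auto
    then show ?case using Cons.IH(1)[of V p "p + 1"] Cons.IH(2)[of V p] by (simp add: row_add_def) }
qed

lemma superdiag_row_add:
  "T \<in> cell ks \<Longrightarrow> superdiag x (row_add i a \<circ> T) = superdiag x T + (if x \<approx> i then a else 0)"
  using cell_diag_one[of T ks "x + 1"] by (simp add: superdiag_def row_add_def)

lemma superdiag_comp:
  "T \<in> cell ks \<Longrightarrow> U \<in> cell ls \<Longrightarrow> superdiag x (T \<circ> U) = superdiag x T + superdiag x U"
proof (induction ks arbitrary: T)
  case Nil
  then show ?case by (simp add: superdiag_def unfolded_one_def)
next
  case (Cons i ks)
  then obtain a V where T: "T = row_add i a \<circ> V" "V \<in> cell ks" by auto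
  then show ?case using superdiag_row_add[OF cell_comp[OF T(2) Cons.prems(2)], of x i a]
      superdiag_row_add[OF T(2), of x i a] Cons.IH[OF T(2) Cons.prems(2)]
    unfolding T(1) comp_assoc by linarith
qed

lemma row_add_in_cell: "c > 0 \<Longrightarrow> row_add i c \<in> cell [i]"
  by (auto intro!: exI[of _ c])

lemma superdiag_row_add_right:
  assumes "T \<in> cell ks" "c > 0"
  shows "superdiag x (T \<circ> row_add i c) = superdiag x T + (if x \<approx> i then c else 0)"
proof -
  have "superdiag x (row_add i c) = (if x \<approx> i then c else 0)"
    by (simp add: superdiag_def row_add_def unfolded_one_def)
  then show ?thesis using superdiag_comp[OF assms(1) row_add_in_cell[OF assms(2)]] by metis
qed

subsection \<open>Left factors\<close>

text \<open>\<open>T\<close> is the left factor, in the cell of \<open>ks\<close>, of the matrix \<open>Z\<close> in the cell of \<open>ws\<close>.\<close>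

definition left_factor :: "int list \<Rightarrow> unfolded \<Rightarrow> int list \<Rightarrow> (unfolded \<Rightarrow> unfolded) \<Rightarrow> bool"
  where "left_factor ws Z ks T \<longleftrightarrow> (\<exists>ls U. red (ks @ ls) \<and> W (ks @ ls) = W ws \<and> T \<in> cell ks \<and> U \<in> cell ls
    \<and> T (U unfolded_one) = Z)"

lemma left_factor_cell: "left_factor ws Z ks T \<Longrightarrow> T \<in> cell ks"
  by (auto simp: left_factor_def)

lemma word_cancel: "W (ks @ ls) = W (ks @ ls') \<Longrightarrow> W ls = W ls'"
  by (rule ext) (metis comp_apply word_append word_inj)

lemma left_factor_change:
  assumes "left_factor ws Z ks T" "W ks = W ks'" "red ks'"
  shows "left_factor ws Z ks' T"
proof -
  obtain ls U where ls: "red (ks @ ls)" "W (ks @ ls) = W ws" "T \<in> cell ks" "U \<in> cell ls"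
    "T (U unfolded_one) = Z" using assms(1) unfolding left_factor_def by blast
  have rk: "red ks" using reduced_appendD[OF ls(1)] by blast
  have w: "W (ks' @ ls) = W (ks @ ls)" using assms(2) by simp
  have "length ks' = length ks" using reduced_length_eq[OF rk assms(3)] assms(2) by simp
  then have "red (ks' @ ls)" using reduced_same_length[OF ls(1) w] by simp
  moreover have "T \<in> cell ks'" using cell_reduced_eq[OF rk assms(3,2)] ls(3) by simp
  ultimately show ?thesis using ls w unfolding left_factor_def by metis
qed

text \<open>Both complementary words represent the same element, hence have the same cell, and
  \<open>cell_prefix_unique\<close> applies.\<close>

lemma left_factor_unique:
  assumes "left_factor ws Z ks T" "left_factor ws Z ks T'"
  shows "T = T'"
proof -
  obtain ls U where ls: "red (ks @ ls)" "W (ks @ ls) = W ws" "T \<in> cell ks" "U \<in> cell ls"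
    "T (U unfolded_one) = Z" using assms(1) unfolding left_factor_def by blast
  obtain ls' U' where ls': "red (ks @ ls')" "W (ks @ ls') = W ws" "T' \<in> cell ks" "U' \<in> cell ls'"
    "T' (U' unfolded_one) = Z" using assms(2) unfolding left_factor_def by blast
  have "W ls' = W ls" using ls(2) ls'(2) word_cancel by metis
  then have "U' \<in> cell ls" using cell_reduced_eq reduced_appendD ls(1) ls'(1,4) by blast
  with ls ls' show ?thesis using cell_prefix_unique by metis
qed

lemma left_factor_inversion:
  assumes "left_factor ws Z ks T" "p < q" "pos ks q < pos ks p"
  shows "pos ws q < pos ws p"
proof -
  obtain ls where ls: "red (ks @ ls)" "W (ks @ ls) = W ws" using assms(1) unfolding left_factor_def by blast
  have "pos (ks @ ls) = pos ws" using ls(2) pos_eq_iff by blast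
  with inversions_persist[OF ls(1) assms(2,3)] show ?thesis by (simp only:)
qed

text \<open>The complementary word has a left descent at \<open>y\<close>; a reduced word of it
  begins with \<open>y\<close>, and this factor is handed over to \<open>T\<close>.\<close>

lemma left_factor_up:
  assumes "left_factor ws Z ks T" "pos ws (W ks (y + 1)) < pos ws (W ks y)"
  shows "\<exists>c>0. left_factor ws Z (ks @ [y]) (T \<circ> row_add y c)"
proof -
  obtain ls U where ls: "red (ks @ ls)" "W (ks @ ls) = W ws" "T \<in> cell ks" "U \<in> cell ls"
    "T (U unfolded_one) = Z" using assms(1) unfolding left_factor_def by blast
  have "pos ws = pos (ks @ ls)" using ls(2) pos_eq_iff by metis
  then have "pos ws q = pos ls (pos ks q)" for q by simp
  then have "pos ls (y + 1) < pos ls y" using assms(2) by simp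
  moreover have rl: "red ls" using ls(1) reduced_appendD by blast
  ultimately obtain us where us: "red (y # us)" "W (y # us) = W ls" using left_descent_word by blast
  then have "U \<in> cell (y # us)" using cell_reduced_eq[OF rl us(1)] ls(4) by simp
  then obtain c V where V: "U = row_add y c \<circ> V" "c > 0" "V \<in> cell us" by auto
  have w: "W ((ks @ [y]) @ us) = W (ks @ ls)" using us(2) by simp
  have "length us + 1 = length ls" using reduced_length_eq[OF rl us] by simp
  then have "red ((ks @ [y]) @ us)" by (intro reduced_same_length[OF ls(1) w]) simp
  moreover have "T \<circ> row_add y c \<in> cell (ks @ [y])" using cell_comp[OF ls(3) row_add_in_cell[OF V(2)]] .
  ultimately have "left_factor ws Z (ks @ [y]) (T \<circ> row_add y c)"
    unfolding left_factor_def using w ls(2,5) V(1,3) by (intro exI[of _ us] exI[of _ V]) simp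
  with V(2) show ?thesis by blast
qed

text \<open>The reverse transfer: a right descent at \<open>y\<close> allows the last factor of
  \<open>T\<close> to be handed to the complement.\<close>

lemma left_factor_down:
  assumes "left_factor ws Z ks T" "W ks (y + 1) < W ks y"
  shows "\<exists>us V c. c > 0 \<and> left_factor ws Z us V \<and> T = V \<circ> row_add y c \<and> W us = W ks \<circ> S y"
proof -
  obtain ls U where ls: "red (ks @ ls)" "W (ks @ ls) = W ws" "T \<in> cell ks" "U \<in> cell ls"
    "T (U unfolded_one) = Z" using assms(1) unfolding left_factor_def by blast
  have rk: "red ks" using reduced_appendD[OF ls(1)] by blast
  obtain us where us: "red (us @ [y])" "W (us @ [y]) = W ks"
    using right_descent_word[OF rk assms(2)] by blast
  have "T \<in> cell (us @ [y])" using cell_reduced_eq[OF rk us(1)] us(2) ls(3) by simp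
  then obtain V c where V: "V \<in> cell us" "c > 0" "T = V \<circ> row_add y c"
    using cell_append_split[of T us "[y]"] by auto
  have w: "W (us @ y # ls) = W (ks @ ls)" by (simp flip: us(2) add: comp_assoc)
  have "length us + 1 = length ks" using reduced_length_eq[OF rk us] by simp
  then have "red (us @ y # ls)" by (intro reduced_same_length[OF ls(1) w]) simp
  moreover have "row_add y c \<circ> U \<in> cell (y # ls)" using V(2) ls(4) by auto
  moreover have "V ((row_add y c \<circ> U) unfolded_one) = Z" using V(3) ls(5) by simp
  ultimately have "left_factor ws Z us V" unfolding left_factor_def using w ls(2) V(1) by metis
  moreover have "W us = W ks \<circ> S y" by (simp flip: us(2) add: comp_assoc)
  ultimately show ?thesis using V(2,3) by blast
qed

lemma left_factor_move:
  assumes "left_factor ws Z ks T" "\<not> x \<approx> y"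
    and "W ks (y + 1) < W ks y \<or> pos ws (W ks (y + 1)) < pos ws (W ks y)"
  shows "\<exists>us V. left_factor ws Z us V \<and> W us = W ks \<circ> S y \<and> superdiag x V = superdiag x T"
  using assms(3)
proof
  assume "W ks (y + 1) < W ks y"
  then obtain us V c where "c > 0" "left_factor ws Z us V" "T = V \<circ> row_add y c" "W us = W ks \<circ> S y"
    using left_factor_down[OF assms(1)] by blast
  then show ?thesis using superdiag_row_add_right[OF left_factor_cell, of ws Z us V c x y] assms(2) by auto
next
  assume "pos ws (W ks (y + 1)) < pos ws (W ks y)"
  then obtain c where c: "c > 0" "left_factor ws Z (ks @ [y]) (T \<circ> row_add y c)"
    using left_factor_up[OF assms(1)] by blast
  have "superdiag x (T \<circ> row_add y c) = superdiag x T"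
    using superdiag_row_add_right[OF left_factor_cell[OF assms(1)] c(1), of x y] assms(2) by simp
  moreover have "W (ks @ [y]) = W ks \<circ> S y" by simp
  ultimately show ?thesis using c(2) by blast
qed

text \<open>Induction on the distance between the wires \<open>r\<close> and \<open>r + 1\<close>.
  The same position \<open>t\<close> is used to move both left factors, which preserves
  \<open>W ls = S r \<circ> W ks\<close>.\<close>

lemma left_factor_superdiag_le:
  assumes "pos ws r = pos ws (r + 1) + 1"
    and "left_factor ws Z ks A" "left_factor ws Z ls B" "W ls = S r \<circ> W ks" "pos ks r < pos ks (r + 1)"
  shows "superdiag x A \<le> superdiag x B"
  using assms(2-)
proof (induction "nat (pos ks (r + 1) - pos ks r)" arbitrary: ks ls A B rule: less_induct)
  case less
  note A = less.prems(1) and B = less.prems(2) and WB = less.prems(3)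
  define y0 y1 where "y0 = pos ks r" and "y1 = pos ks (r + 1)"
  have y: "W ks y0 = r" "W ks y1 = r + 1" by (simp_all add: y0_def y1_def)
  have lt: "y0 < y1" using less.prems(4) by (simp add: y0_def y1_def)
  have inv: "pos ws q < pos ws p" if "p < q" "pos ks q < pos ks p" for p q
    using left_factor_inversion[OF A that] .
  \<comment> \<open>Otherwise the wires \<open>r + 1\<close> and \<open>r + int n\<close> would be
    inverted in \<open>ks\<close>, hence in \<open>ws\<close>, where \<open>r + int n\<close> comes
    after \<open>r + 1\<close>. So the positions from \<open>y0\<close> to \<open>y1\<close> are
    pairwise incongruent.\<close>
  have bound: "y1 < y0 + int n"
  proof -
    have "pos ks (r + int n) = y0 + int n" "pos ws (r + int n) = pos ws r + int n"
      using word_shift[of _ r 1] by (simp_all add: y0_def)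
    then have "\<not> y0 + int n < y1" using inv[of "r + 1" "r + int n"] n_ge_2 assms(1) by (auto simp: y1_def)
    moreover have "y1 \<noteq> y0 + int n" using y word_shift[of ks y0 1] n_ge_2 by auto
    ultimately show ?thesis by simp
  qed
  have cgr0: "p = q" if "p \<approx> q" "y0 \<le> p" "p \<le> y1" "y0 \<le> q" "q \<le> y1" for p q
    using cgr_close[OF that(1)] that bound by auto
  show ?case
  proof (cases "y1 = y0 + 1")
    case True
    obtain c where c: "c > 0" "left_factor ws Z (ks @ [y0]) (A \<circ> row_add y0 c)"
      using left_factor_up[OF A, of y0] y True assms(1) by auto
    \<comment> \<open>The extension of \<open>A\<close> by \<open>y0\<close> belongs to the same
      element as \<open>B\<close>, so uniqueness identifies them.\<close>
    have "S r \<circ> W ks = W ks \<circ> S y0" using word_gen_commute[of ks y0 r] y True by simp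
    then have w: "W (ks @ [y0]) = W ls" using WB by simp
    have "red ls" using B reduced_appendD unfolding left_factor_def by blast
    then have "B = A \<circ> row_add y0 c" using left_factor_unique[OF B] left_factor_change[OF c(2) w] by blast
    then show ?thesis using superdiag_row_add_right[OF left_factor_cell[OF A] c(1)] c(1) by simp
  next
    case False
    then have far: "y0 + 1 < y1" using lt by simp
    \<comment> \<open>Wires strictly between are not translates of \<open>r\<close> or
      \<open>r + 1\<close>, so they sit at the same positions in \<open>ls\<close>.\<close>
    have fixed: "S r p = p \<and> p \<noteq> r \<and> p \<noteq> r + 1" if "W ks y = p" "y0 < y" "y < y1" for p y
    proof -
      have "\<not> W ks y \<approx> W ks y0" "\<not> W ks y \<approx> W ks y1"
        using cgr0[of y y0] cgr0[of y y1] that(2,3) by auto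
      then have "\<not> p \<approx> r" "\<not> p \<approx> r + 1" using that(1) y by simp_all
      then show ?thesis using gen_other by auto
    qed
    \<comment> \<open>Move the rightmost inner wire out past \<open>y1\<close>, unless this uses the
      class of \<open>x\<close>; then move the leftmost one out past \<open>y0\<close>. Either way
      the distance drops by 1.\<close>
    obtain t where t: "\<not> x \<approx> t" "W ks (t + 1) < W ks t \<or> pos ws (W ks (t + 1)) < pos ws (W ks t)"
      "W ls (t + 1) < W ls t \<or> pos ws (W ls (t + 1)) < pos ws (W ls t)"
      "S t y0 < S t y1" "S t y1 - S t y0 < y1 - y0"
    proof (cases "x \<approx> y1 - 1")
      case False
      define p where "p = W ks (y1 - 1)"
      have p: "S r p = p" "p \<noteq> r" "p \<noteq> r + 1" "pos ks p = y1 - 1"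
        using fixed[of "y1 - 1" p] far by (simp_all add: p_def)
      have cmp: "p < r \<or> r + 1 < p" using p(2,3) by linarith
      have ls: "W ls (y1 - 1) = p" "W ls y1 = r" using WB y p(1) by (simp_all add: p_def gen_at_Suc)
      \<comment> \<open>A wire \<open>p > r + 1\<close> gives a descent at once. A wire
        \<open>p < r\<close> is already inverted with \<open>r\<close>, hence so in
        \<open>ws\<close>, and there with \<open>r + 1\<close> too since the two are
        adjacent.\<close>
      have less: "pos ws r < pos ws p" if "p < r" using inv[OF that] far p(4) by (simp add: y0_def)
      have S: "S (y1 - 1) y1 = y1 - 1" "S (y1 - 1) y0 = y0"
        using cgr0[of y0 "y1 - 1"] cgr0[of y0 y1] far by (auto intro!: gen_at_Suc gen_other)
      show ?thesis
      proof (rule that[of "y1 - 1"])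
        show "\<not> x \<approx> y1 - 1" by fact
        show "W ks (y1 - 1 + 1) < W ks (y1 - 1) \<or> pos ws (W ks (y1 - 1 + 1)) < pos ws (W ks (y1 - 1))"
          using cmp less y(2) assms(1) by (auto simp flip: p_def)
        show "W ls (y1 - 1 + 1) < W ls (y1 - 1) \<or> pos ws (W ls (y1 - 1 + 1)) < pos ws (W ls (y1 - 1))"
          using cmp less ls by auto
      qed (use S far in auto)
    next
      case True
      define p where "p = W ks (y0 + 1)"
      have p: "S r p = p" "p \<noteq> r" "p \<noteq> r + 1" "pos ks p = y0 + 1"
        using fixed[of "y0 + 1" p] far by (simp_all add: p_def)
      have cmp: "p < r \<or> r + 1 < p" using p(2,3) by linarith
      have ls: "W ls (y0 + 1) = p" "W ls y0 = r + 1" using WB y p(1) by (simp_all add: p_def gen_at)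
      \<comment> \<open>The mirror image: now \<open>p < r\<close> gives the descent, and
        \<open>p > r + 1\<close> is inverted with \<open>r + 1\<close> in \<open>ws\<close>, hence
        with \<open>r\<close>.\<close>
      have less: "pos ws p < pos ws (r + 1)" if "r + 1 < p" using inv[OF that] far p(4) by (simp add: y1_def)
      have S: "S y0 y0 = y0 + 1" "S y0 y1 = y1"
        using cgr0[of y1 "y0 + 1"] cgr0[of y1 y0] far by (auto intro!: gen_at gen_other)
      show ?thesis
      proof (rule that[of y0])
        show "\<not> x \<approx> y0"
          using True cgr0[of "y1 - 1" y0] far by (metis cong_sym cong_trans add.commute diff_add_cancel less_le
              linorder_not_le zle_diff1_eq add_le_imp_le_diff)
        show "W ks (y0 + 1) < W ks y0 \<or> pos ws (W ks (y0 + 1)) < pos ws (W ks y0)"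
          using cmp less y(1) assms(1) by (auto simp flip: p_def)
        show "W ls (y0 + 1) < W ls y0 \<or> pos ws (W ls (y0 + 1)) < pos ws (W ls y0)"
          using cmp less ls by auto
      qed (use S far in auto)
    qed
    obtain us A' where us: "left_factor ws Z us A'" "W us = W ks \<circ> S t" "superdiag x A' = superdiag x A"
      using left_factor_move[OF A t(1,2)] by blast
    obtain vs B' where vs: "left_factor ws Z vs B'" "W vs = W ls \<circ> S t" "superdiag x B' = superdiag x B"
      using left_factor_move[OF B t(1,3)] by blast
    have "W us = W (ks @ [t])" using us(2) by simp
    then have "pos us = pos (ks @ [t])" using pos_eq_iff by blast
    then have posu: "pos us r = S t y0" "pos us (r + 1) = S t y1" by (simp_all add: y0_def y1_def)
    have "W vs = S r \<circ> W us" using us(2) vs(2) WB by (simp add: comp_assoc)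
    then have "superdiag x A' \<le> superdiag x B'"
      using less.hyps[of us A' vs B'] us(1) vs(1) t(4,5) posu by (simp add: y0_def y1_def)
    then show ?thesis using us(3) vs(3) by simp
  qed
qed

section \<open>The inequality for two factorizations of one matrix\<close>

lemma chevalley_prod_diag:
  "length as = length ks \<Longrightarrow>
    chevalley_prod n ks as p p = 1 \<and> (\<forall>q<p. chevalley_prod n ks as p q = 0)"
  by (induction as ks arbitrary: p rule: list_induct2) (auto simp: unfolded_one_def row_add_def)

lemma chevalley_prod_superdiag:
  "length as = length ks \<Longrightarrow>
    chevalley_prod n ks as x (x + 1) = (\<Sum>s<length ks. if ks ! s \<approx> x then as ! s else 0)"
proof (induction as ks rule: list_induct2)
  case (Cons a as i ks)
  then show ?case using chevalley_prod_diag[OF Cons.hyps, of "x + 1"]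
    by (simp add: row_add_def sum.lessThan_Suc_shift cong_sym_eq[of x] cong: if_cong del: sum.lessThan_Suc)
qed (simp add: unfolded_one_def)

lemma exchange_sum_le:
  assumes r1: "red (r # ks)" and r2: "red (ks @ [j])"
    and len: "length \<alpha> = length ks" "length \<alpha>' = length ks"
    and pos: "a > 0" "\<forall>b\<in>set \<alpha>. b > 0" "a' > 0" "\<forall>b\<in>set \<alpha>'. b > 0"
    and eq: "chevalley_prod n (r # ks) (a # \<alpha>) = chevalley_prod n (ks @ [j]) (\<alpha>' @ [a'])"
    and m: "m \<le> length ks"
  shows "(\<Sum>s<m. if ks ! s \<approx> x then \<alpha>' ! s else 0)
    \<le> (if x \<approx> r then a else 0) + (\<Sum>s<m. if ks ! s \<approx> x then \<alpha> ! s else 0)"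
proof -
  define ws Z where "ws = r # ks" and "Z = chevalley_prod n (r # ks) (a # \<alpha>)"
  let ?us = "take m ks" and ?vs = "drop m ks"
  have pos': "\<forall>b\<in>set (take m \<alpha>'). b > 0" "\<forall>b\<in>set (drop m \<alpha>'). b > 0"
    "\<forall>b\<in>set (take m \<alpha>). b > 0" "\<forall>b\<in>set (drop m \<alpha>). b > 0"
    using pos(2,4) by (auto dest: in_set_takeD in_set_dropD)
  obtain T U where T: "T \<in> cell ?us" "U \<in> cell (?vs @ [j])"
    "chevalley_prod n (?us @ ?vs @ [j]) (take m \<alpha>' @ drop m \<alpha>' @ [a']) = T (U unfolded_one)"
    "chevalley_prod n ?us (take m \<alpha>') = T unfolded_one"
    using chevalley_prod_append_cell[of "take m \<alpha>'" ?us "drop m \<alpha>' @ [a']" "?vs @ [j]"] len pos(3) pos' m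
    by auto
  obtain V Q where V: "V \<in> cell (r # ?us)" "Q \<in> cell ?vs"
    "chevalley_prod n ((r # ?us) @ ?vs) ((a # take m \<alpha>) @ drop m \<alpha>) = V (Q unfolded_one)"
    "chevalley_prod n (r # ?us) (a # take m \<alpha>) = V unfolded_one"
    using chevalley_prod_append_cell[of "a # take m \<alpha>" "r # ?us" "drop m \<alpha>" ?vs] len pos(1) pos' m
    by (auto simp del: cell.simps chevalley_prod_Cons)
  have words: "?us @ ?vs @ [j] = ks @ [j]" "(r # ?us) @ ?vs = ws" by (simp_all add: ws_def flip: append_assoc)
  have TZ: "T (U unfolded_one) = Z" and VZ: "V (Q unfolded_one) = Z"
    using T(3) V(3) words eq by (simp_all add: Z_def ws_def del: chevalley_prod_Cons flip: append_assoc)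
  have "T \<circ> U \<in> cell (ks @ [j])" "V \<circ> Q \<in> cell ws"
    using cell_comp[OF T(1,2)] cell_comp[OF V(1,2)] words by (simp_all del: cell.simps flip: append_assoc)
  \<comment> \<open>Both words are reduced and \<open>Z\<close> lies in both cells, so disjointness
    forces one group element.\<close>
  then have W: "W (ks @ [j]) = W ws"
    using cell_disjoint[OF r2 r1] TZ VZ by (simp add: ws_def del: cell.simps word_append word_Cons)
  have "left_factor ws Z ?us T" "left_factor ws Z (r # ?us) V"
    unfolding left_factor_def using T V TZ VZ words W r1 r2 ws_def by metis+
  moreover have "W (r # ?us) = S r \<circ> W ?us" by simp
  moreover have "pos ?us r < pos ?us (r + 1)"
    using reduced_appendD[of "r # ?us" ?vs] words(2) r1 reduced_Cons ws_def by metis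
  \<comment> \<open>Comparing the two words of this element shows that \<open>S j\<close> takes the
    position of \<open>r\<close> in \<open>ks\<close> to that of \<open>r + 1\<close>, so the wires
    are adjacent there; the first letter \<open>r\<close> of \<open>ws\<close> then inverts
    them.\<close>
  moreover have "pos ws r = pos ws (r + 1) + 1"
  proof -
    have "pos ks r < pos ks (r + 1)" using r1 reduced_Cons by blast
    moreover have "W ks (S j (pos ks r)) = r + 1"
      using fun_cong[OF W, of "pos ks r"] by (simp add: ws_def gen_at)
    then have "pos ks (r + 1) = S j (pos ks r)" by (metis pos_word)
    ultimately have "pos ks (r + 1) = pos ks r + 1"
      by (cases rule: gen_cases[of "pos ks r" j]) auto
    then show ?thesis by (simp add: ws_def gen_at gen_at_Suc)
  qed
  ultimately have "superdiag x T \<le> superdiag x V" by (intro left_factor_superdiag_le)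
  then have "chevalley_prod n ?us (take m \<alpha>') x (x + 1) \<le> chevalley_prod n (r # ?us) (a # take m \<alpha>) x (x + 1)"
    unfolding T(4) V(4) superdiag_def .
  moreover have "chevalley_prod n ?us (take m b) x (x + 1) = (\<Sum>s<m. if ks ! s \<approx> x then b ! s else 0)"
    if "length b = length ks" for b
    using chevalley_prod_superdiag[of "take m b" ?us x] that m by (auto simp: min_absorb2 intro!: sum.cong)
  moreover have "chevalley_prod n (r # ?us) (a # take m \<alpha>) x (x + 1) =
    (if x \<approx> r then a else 0) + chevalley_prod n ?us (take m \<alpha>) x (x + 1)"
    using chevalley_prod_diag[of "take m \<alpha>" ?us "x + 1"] len(1) by (simp add: row_add_def)
  ultimately show ?thesis using len by simp
qed

end

theorem theorem8p1:
  fixes n m :: nat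
    and r j x :: int
    and ks :: "int list"
    and a a' :: real
    and \<alpha> \<alpha>' :: "real list"
  assumes "n \<ge> 2"
    and "reduced_word n (r # ks)"
    and "reduced_word n (ks @ [j])"
    and "length \<alpha> = length ks"
    and "length \<alpha>' = length ks"
    and "a > 0" and "\<forall>b \<in> set \<alpha>. b > 0"
    and "a' > 0" and "\<forall>b \<in> set \<alpha>'. b > 0"
    and "chevalley_prod n (r # ks) (a # \<alpha>) = chevalley_prod n (ks @ [j]) (\<alpha>' @ [a'])"
    and "m \<le> length ks"
  shows "let S = {s. s < m \<and> [ks ! s = x] (mod int n)} in
    (\<Sum>s\<in>S. \<alpha>' ! s) \<le>
      (if [x = r] (mod int n) then a + (\<Sum>s\<in>S. \<alpha> ! s) else (\<Sum>s\<in>S. \<alpha> ! s))"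
proof -
  interpret affine_rank n using assms(1) by unfold_locales
  have "(\<Sum>s\<in>{s. s < m \<and> ks ! s \<approx> x}. b ! s) = (\<Sum>s<m. if ks ! s \<approx> x then b ! s else 0)" for b :: "real list"
    by (simp add: sum.inter_filter[symmetric] lessThan_def)
  then show ?thesis using exchange_sum_le[OF assms(2-11), of x] by (auto simp: Let_def split: if_splits)
qed

end
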